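(* Let $q$ be a prime power. (a) Let $f\in\mathbb{F}_q[x]$ be a polynomial having a non-zero root $\omega$ (in some extension field of $\mathbb{F}_q$), let $t$ be a positive integer, and let $m=\deg(f)$. The following are equivalent. (i) The polynomial $f$ is $t$-hyper-irreducible. (ii) The integers $t,q$ are coprime and $\mathrm{ord}(q;|\omega|t)=mt$. (iii) We have $\mathrm{ord}(q;|\omega|)=m$, the integer $\gcd(4,t)$ divides $|\omega|$, and each prime divisor of $t$ divides $|\omega|$ but does not divide $(q^m-1)/|\omega|$. (b) Let $m,t$ be positive integers. The following are equivalent. (i) There exists a $t$-hyper-irreducible polynomial of degree $m$ in $\mathbb{F}_q[x]$. (ii) The integers $t,q$ are coprime and $\mathrm{ord}(q;(q^m-1)t)=mt$. (iii) Writing $t_1,\dots,t_\ell$ for all the distinct odd prime divisors of $t$, we have $\gcd(t,4)\prod_{i=1}^{\ell}t_i \mid (q^m-1)$.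
   Context: $\mathbb{F}_q$ is the finite field with $q$ elements. For a positive integer $t$, a polynomial $f\in\mathbb{F}_q[x]$ is called $t$-hyper-irreducible if $f(x^t)$ is irreducible over $\mathbb{F}_q$. A root of $f \in \mathbb{F}_q[x]$ is an element $\omega$ of some (possibly non-proper) finite extension field of $\mathbb{F}_q$ with $f(\omega)=0$; for $\omega\neq 0$, $|\omega|$ denotes its multiplicative order. For coprime positive integers $a,r$, $\mathrm{ord}(a;r)$ denotes the smallest positive integer $n$ such that $r$ divides $a^n-1$. *)

theory Defs
  imports
    "HOL-Number_Theory.Pocklington"
    "HOL-Number_Theory.Prime_Powers"
    "HOL-Computational_Algebra.Polynomial_Factorial"
    "Jordan_Normal_Form.Ring_Hom_Matrix"
begin

text \<open>
  The field with q elements is a type of class \<^class>\<open>field\<close> and \<^class>\<open>finite\<close> of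
  cardinality q.  A finite extension of it is another such type together with a field
  homomorphism (which is automatically injective) from the first type into the second.
\<close>

definition hyper_irreducible :: "nat \<Rightarrow> 'a::field poly \<Rightarrow> bool" where
  "hyper_irreducible t f \<longleftrightarrow> Factorial_Ring.irreducible (f \<circ>\<^sub>p Polynomial.monom 1 t)"

definition ext_root :: "('a::field \<Rightarrow> 'b::field) \<Rightarrow> 'a poly \<Rightarrow> 'b \<Rightarrow> bool" where
  "ext_root h f w \<longleftrightarrow> field_hom h \<and> poly (map_poly h f) w = 0"

text \<open>
  The library's \<open>ord\<close> covers only naturals modulo a number.  The value below is
  meaningful for every non-zero element of a finite field, where such an n exists.
\<close>

definition mult_order :: "'a::field \<Rightarrow> nat" where
  "mult_order w = (LEAST n. n > 0 \<and> w ^ n = 1)"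

text \<open>
  For coprime a and r, the number ord(a;r) is the library's \<open>ord r a\<close>: the modulus is the
  first argument.
\<close>

end

theory Submission
  imports Defs "Jordan_Normal_Form.Char_Poly" "HOL-Algebra.Algebraic_Closure_Type"
begin

text \<open>
  Let n be the order of the root \<open>\<omega>\<close>. In an algebraic closure, \<open>\<omega>\<close> has a t-th root z of order n t
  as soon as t is coprime to q; since z is a root of f(x^t), and the minimal polynomial of z has
  degree ord(q; n t), f(x^t) is irreducible if and only if ord(q; n t) = deg f * t.
  If t is not coprime to q, then f(x^t) is a p-th power in characteristic p.

  On the arithmetic side, for every prime p one has ord(q; n p) \<open>\<le>\<close> p ord(q; n), with equality if and
  only if p divides n but not (q^ord(q; n) - 1) / n. Hence ord(q; n t) \<open>\<le>\<close> t ord(q; n), and equality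
  holds if and only if it holds in each prime step; the condition on gcd(4, t) comes from the step
  from 2 n to 4 n, the only one in which the condition on the quotient is not inherited. As
  ord(q; n) \<open>\<le>\<close> deg f, this turns (ii) into (iii).
\<close>

hide_const (open) Polynomials.degree Polynomials.lead_coeff Divisibility.irreducible Divisibility.prime

section \<open>Multiplicative orders modulo products\<close>

lemma ord_dvd_iff_dvd:
  fixes n q :: nat
  assumes "q > 0"
  shows "ord n q dvd k \<longleftrightarrow> n dvd q ^ k - 1"
proof -
  have "[q ^ k = 1] (mod n) \<longleftrightarrow> n dvd q ^ k - 1"
    using assms by (metis One_nat_def Suc_leI cong_altdef_nat zero_less_power)
  then show ?thesis unfolding ord_divides .
qed

lemma dvd_power_ord_minus_one:
  fixes n q :: nat
  assumes "q > 0"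
  shows "n dvd q ^ ord n q - 1"
  by (rule ord_dvd_iff_dvd[OF assms, THEN iffD1]) (rule dvd_refl)

lemma ord_dvd_mono:
  fixes n n' q :: nat
  assumes "n dvd n'"
  shows "ord n q dvd ord n' q"
  unfolding ord_divides[symmetric] by (rule cong_dvd_modulus_nat[OF ord assms])

section \<open>Geometric sums modulo primes\<close>

text \<open>Raising the exponent from d to d p multiplies q^d - 1 by this sum, so the growth of the
  orders is governed by the prime powers in it.\<close>

lemma power_minus_one_mult_sum:
  fixes q :: nat
  assumes "q > 0"
  shows "q ^ (d * p) - 1 = (q ^ d - 1) * (\<Sum>i<p. (q ^ d) ^ i)"
proof -
  have "int (q ^ (d * p) - 1) = (int q ^ d) ^ p - 1"
    using assms by (simp add: of_nat_diff power_mult)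
  also have "\<dots> = (int q ^ d - 1) * (\<Sum>i<p. (int q ^ d) ^ i)"
    by (rule power_diff_1_eq)
  also have "\<dots> = int ((q ^ d - 1) * (\<Sum>i<p. (q ^ d) ^ i))"
    using assms by (simp add: of_nat_diff)
  finally show ?thesis by linarith
qed

lemma cong_geometric_sum:
  fixes Q r :: nat
  assumes "[Q = 1] (mod r)"
  shows "[(\<Sum>i<p. Q ^ i) = p] (mod r)"
proof -
  have "[(\<Sum>i<p. Q ^ i) = (\<Sum>i<p. 1)] (mod r)"
    by (intro cong_sum) (use assms cong_pow[of Q 1 r] in auto)
  then show ?thesis by simp
qed

text \<open>With Q = 1 + p u, each Q^i is 1 + i p u modulo p^2, so the sum is p + p u p (p - 1) / 2,
  which is p modulo p^2 when p is odd. For p = 2 the sum is 1 + Q, and Q = 1 modulo 4 keeps 4 from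
  dividing it.\<close>

lemma not_square_dvd_geometric_sum:
  fixes p Q :: nat
  assumes "prime p" "[Q = 1] (mod p)" "p = 2 \<Longrightarrow> [Q = 1] (mod 4)"
  shows "\<not> p ^ 2 dvd (\<Sum>i<p. Q ^ i)"
proof (cases "p = 2")
  case True
  have "Q mod 4 = 1" using assms(3)[OF True] by (simp add: cong_def)
  then have "\<not> 4 dvd 1 + Q" by presburger
  moreover have "(\<Sum>i<2. Q ^ i) = 1 + Q" by (simp add: numeral_2_eq_2)
  ultimately show ?thesis using True by simp
next
  case False
  then have odd: "odd p" using assms(1) prime_odd_nat prime_ge_2_nat[of p] by simp
  have "int p dvd int Q - 1"
    using assms(2) by (simp add: cong_iff_dvd_diff flip: cong_int_iff)
  then obtain u where "int Q - 1 = int p * u" by (rule dvdE)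
  then have u: "int Q = 1 + int p * u" by simp
  have pow: "[int Q ^ i = 1 + int i * (int p * u)] (mod int p ^ 2)" for i
  proof (induction i)
    case (Suc i)
    have "[int Q * int Q ^ i = (1 + int p * u) * (1 + int i * (int p * u))] (mod int p ^ 2)"
      using Suc u by (intro cong_mult) auto
    also have "(1 + int p * u) * (1 + int i * (int p * u))
        = 1 + int (Suc i) * (int p * u) + int p ^ 2 * (int i * u ^ 2)"
      by (simp add: algebra_simps power2_eq_square)
    also have "[\<dots> = 1 + int (Suc i) * (int p * u)] (mod int p ^ 2)"
      by (simp add: cong_iff_dvd_diff)
    finally show ?case by simp
  qed auto
  obtain k where k: "p = 2 * k + 1" using odd by (rule oddE)
  have "(\<Sum>i<p. int i) = int p * int k"
  proof -
    have "2 * (\<Sum>i<n. int i) = int n * (int n - 1)" for n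
      by (induction n) (auto simp: algebra_simps)
    from this[of p] show ?thesis using k by simp
  qed
  then have "(\<Sum>i<p. 1 + int i * (int p * u)) = int p + int p ^ 2 * (int k * u)"
    by (simp add: sum.distrib flip: sum_distrib_right) (simp add: power2_eq_square)
  moreover have "[(\<Sum>i<p. int Q ^ i) = (\<Sum>i<p. 1 + int i * (int p * u))] (mod int p ^ 2)"
    by (intro cong_sum pow)
  ultimately have "[(\<Sum>i<p. int Q ^ i) = int p] (mod int p ^ 2)"
    by (metis cong_add_lcancel_0 cong_mult_self_left cong_trans)
  then have "[(\<Sum>i<p. Q ^ i) = p] (mod p ^ 2)"
    by (simp flip: cong_int_iff)
  moreover have "\<not> p ^ 2 dvd p"
    using prime_gt_1_nat[OF assms(1)] by (auto simp: power2_eq_square dest: dvd_imp_le)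
  ultimately show ?thesis by (metis cong_dvd_iff)
qed

section \<open>Orders modulo n t compared with orders modulo n\<close>

text \<open>If p does not divide n, the order is the lcm of d = ord(q; n) and ord(q; p), hence at
  most d (p - 1). If p divides n, the geometric sum contributes a factor p, so the order is a
  multiple of d dividing d p; it is d exactly when n p divides q^d - 1.\<close>

lemma ord_mult_prime:
  fixes n p q :: nat
  assumes "prime p" "n > 0" "q > 0" "coprime (n * p) q"
  shows ord_mult_prime_le: "ord (n * p) q \<le> p * ord n q"
    and ord_mult_prime_eq_iff:
      "ord (n * p) q = p * ord n q \<longleftrightarrow> p dvd n \<and> \<not> p dvd (q ^ ord n q - 1) div n"
proof -
  define d where "d = ord n q"
  have cop: "coprime n q" "coprime p q" using assms(4) by auto
  then have "d > 0" by (simp add: d_def)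
  have "ord (n * p) q \<le> p * d \<and>
    (ord (n * p) q = p * d \<longleftrightarrow> p dvd n \<and> \<not> p dvd (q ^ d - 1) div n)"
  proof (cases "p dvd n")
    case False
    have "coprime n p" using False assms(1) by (metis coprime_commute prime_imp_coprime)
    then have "ord (n * p) q = lcm d (ord p q)"
      unfolding d_def by (rule ord_modulus_mult_coprime)
    also have "\<dots> \<le> d * ord p q"
      using cop \<open>d > 0\<close> by (intro dvd_imp_le lcm_least) simp_all
    also have "ord p q \<le> p - 1"
      using dvd_imp_le[OF order_divides_totient[OF cop(2)]] prime_gt_1_nat[OF assms(1)]
      by (simp add: totient_prime[OF assms(1)])
    then have "d * ord p q < d * p"
      using \<open>d > 0\<close> prime_gt_0_nat[OF assms(1)] by simp
    finally show ?thesis using False by (simp add: mult.commute)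
  next
    case True
    have n_dvd: "n dvd q ^ d - 1" unfolding d_def by (rule dvd_power_ord_minus_one[OF assms(3)])
    then have "[q ^ d = 1] (mod p)"
      by (metis True cong_dvd_modulus_nat d_def ord)
    then have "p dvd (\<Sum>i<p. (q ^ d) ^ i)"
      by (metis cong_geometric_sum cong_dvd_iff dvd_refl)
    then have "n * p dvd q ^ (d * p) - 1"
      unfolding power_minus_one_mult_sum[OF assms(3)] by (intro mult_dvd_mono n_dvd)
    then have "ord (n * p) q dvd d * p" using ord_dvd_iff_dvd[OF assms(3)] by blast
    moreover have "d dvd ord (n * p) q" unfolding d_def by (rule ord_dvd_mono) simp
    ultimately obtain e where e: "ord (n * p) q = d * e" "e dvd p"
      using \<open>d > 0\<close> by (metis dvd_def nat_mult_dvd_cancel1)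
    then have "e = 1 \<or> e = p" using assms(1) prime_nat_iff by blast
    moreover have "n * p dvd q ^ d - 1 \<longleftrightarrow> p dvd (q ^ d - 1) div n"
      using n_dvd assms(2) by (auto elim!: dvdE)
    then have "ord (n * p) q dvd d \<longleftrightarrow> p dvd (q ^ d - 1) div n"
      using ord_dvd_iff_dvd[OF assms(3)] by blast
    ultimately show ?thesis
      using e \<open>d > 0\<close> prime_gt_1_nat[OF assms(1)] True by (auto simp: mult.commute)
  qed
  then show "ord (n * p) q \<le> p * ord n q"
    and "ord (n * p) q = p * ord n q \<longleftrightarrow> p dvd n \<and> \<not> p dvd (q ^ ord n q - 1) div n"
    by (simp_all add: d_def)
qed

text \<open>The prime factors of t are moved into n one at a time, hence the induction with n
  arbitrary.\<close>

lemma ord_mult_le: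
  fixes n t q :: nat
  assumes "n > 0" "t > 0" "q > 0" "coprime (n * t) q"
  shows "ord (n * t) q \<le> t * ord n q"
  using assms
proof (induction t arbitrary: n rule: less_induct)
  case (less t)
  show ?case
  proof (cases "t = 1")
    case False
    then obtain p s where p: "prime p" "t = p * s"
      using prime_factor_nat by (metis dvdE)
    then have "s > 0" "s < t" using less.prems prime_gt_1_nat[of p] by auto
    have cop: "coprime (n * p) q" "coprime (n * p * s) q"
      using less.prems p by (auto simp: mult.assoc)
    have "ord (n * t) q = ord (n * p * s) q" by (simp add: p mult.assoc)
    also have "\<dots> \<le> s * ord (n * p) q"
      using less.prems p cop \<open>s > 0\<close> \<open>s < t\<close> by (intro less.IH) auto
    also have "\<dots> \<le> s * (p * ord n q)"
      using less.prems p cop by (intro mult_left_mono ord_mult_prime_le) auto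
    finally show ?thesis by (simp add: p mult_ac)
  qed auto
qed

text \<open>A prime p of t moves into n and multiplies the order by p; the work is to carry the
  hypotheses from n and t = p s over to n p and s. The quotient for n p is the quotient for n times
  S / p, with S the geometric sum.\<close>

lemma ord_mult_eq:
  fixes n t q :: nat
  assumes "n > 0" "t > 0" "q > 0" "coprime n q" "gcd 4 t dvd n"
    and "\<And>p. prime p \<Longrightarrow> p dvd t \<Longrightarrow> p dvd n \<and> \<not> p dvd (q ^ ord n q - 1) div n"
  shows "coprime t q \<and> ord (n * t) q = t * ord n q"
  using assms
proof (induction t arbitrary: n rule: less_induct)
  case (less t)
  show ?case
  proof (cases "t = 1")
    case False
    then obtain p s where p: "prime p" "t = p * s"
      using prime_factor_nat by (metis dvdE)
    then have "s > 0" "s < t" using less.prems prime_gt_1_nat[of p] by auto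
    have pn: "p dvd n" "\<not> p dvd (q ^ ord n q - 1) div n" using less.prems p by auto
    have "coprime p q" by (rule coprime_divisors[OF pn(1) dvd_refl less.prems(4)])
    then have cop: "coprime p q" "coprime (n * p) q" using less.prems(4) by simp_all
    have ordp: "ord (n * p) q = p * ord n q"
      using pn less.prems p cop by (subst ord_mult_prime_eq_iff) auto
    define d where "d = ord n q"
    define S where "S = (\<Sum>i<p. (q ^ d) ^ i)"
    have n_dvd: "n dvd q ^ d - 1" unfolding d_def by (rule dvd_power_ord_minus_one[OF less.prems(3)])
    have Q1: "[q ^ d = 1] (mod r)" if "r dvd n" for r
      by (metis that cong_dvd_modulus_nat d_def ord)
    have "p dvd S" unfolding S_def by (metis cong_geometric_sum[OF Q1[OF pn(1)]] cong_dvd_iff dvd_refl)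
    then have quot: "(q ^ (d * p) - 1) div (n * p) = ((q ^ d - 1) div n) * (S div p)"
      unfolding power_minus_one_mult_sum[OF less.prems(3)] S_def
      by (rule div_mult_div_if_dvd[OF n_dvd, symmetric])
    have "coprime s q \<and> ord (n * p * s) q = s * ord (n * p) q"
    proof (rule less.IH[OF \<open>s < t\<close>])
      have "gcd 4 s dvd gcd 4 t" using p by (simp add: gcd_dvd1 gcd_dvd2 dvd_mult)
      then show "gcd 4 s dvd n * p" using less.prems(5) by (meson dvd_mult2 dvd_trans)
      fix r :: nat assume r: "prime r" "r dvd s"
      then have rn: "r dvd n" "\<not> r dvd (q ^ d - 1) div n"
        using less.prems(6)[of r] p by (auto simp: d_def)
      \<comment> \<open>Modulo a prime r that divides n, S is congruent to p, which settles r
        different from p. For r = p, the square p^2 would divide S.\<close>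
      have "\<not> r dvd S div p"
      proof
        assume "r dvd S div p"
        then have rS: "r * p dvd S" using \<open>p dvd S\<close> p by (metis dvd_div_mult_self dvd_mult_cancel_right mult_dvd_mono dvd_refl)
        show False
        proof (cases "r = p")
          case True
          \<comment> \<open>If r = p = 2, then t is a multiple of 4, so the hypothesis on
            \<open>gcd 4 t\<close> makes n one too.\<close>
          have "[q ^ d = 1] (mod 4)" if "p = 2"
          proof -
            have "4 dvd t" using that p r True by (auto elim!: dvdE)
            then show ?thesis using less.prems(5) Q1 by (simp add: gcd_nat.absorb1)
          qed
          then have "\<not> p ^ 2 dvd S"
            using not_square_dvd_geometric_sum[OF p(1) Q1[OF pn(1)]] by (simp add: S_def)
          then show False using rS True by (simp add: power2_eq_square)
        next
          case False
          have "[S = p] (mod r)" unfolding S_def by (rule cong_geometric_sum[OF Q1[OF rn(1)]])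
          moreover have "r dvd S" using rS by (rule dvd_mult_left)
          ultimately have "r dvd p" by (simp add: cong_dvd_iff)
          then show False using False primes_dvd_imp_eq[OF r(1) p(1)] by simp
        qed
      qed
      then show "r dvd n * p \<and> \<not> r dvd (q ^ ord (n * p) q - 1) div (n * p)"
        using rn r(1) quot \<open>\<not> r dvd S div p\<close> unfolding ordp d_def[symmetric]
        by (simp add: mult.commute prime_dvd_mult_iff)
    qed (use less.prems p cop \<open>s > 0\<close> in \<open>auto simp: prime_gt_0_nat\<close>)
    then show ?thesis using ordp p cop by (auto simp: mult_ac)
  qed auto
qed

lemma ord_mult_eq_imp:
  fixes n t q :: nat
  assumes "n > 0" "t > 0" "q > 0" "coprime n q" "coprime t q" "ord (n * t) q = t * ord n q"
  shows "gcd 4 t dvd n"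
    and "prime p \<Longrightarrow> p dvd t \<Longrightarrow> p dvd n \<and> \<not> p dvd (q ^ ord n q - 1) div n"
proof -
  \<comment> \<open>ord(q; n s u) \<open>\<le>\<close> u ord(q; n s) \<open>\<le>\<close> s u ord(q; n), so equality for t = s u forces equality for s.\<close>
  have full: "ord (n * s) q = s * ord n q" if s: "s dvd t" for s
  proof -
    obtain u where u: "t = s * u" using s by (rule dvdE)
    have pos: "s > 0" "u > 0" using assms(2) u by auto
    have cop: "coprime (n * s) q" "coprime (n * s * u) q" using assms(4,5) u by auto
    have "u * (s * ord n q) = ord (n * s * u) q" using assms(6) by (simp add: u mult_ac)
    also have "\<dots> \<le> u * ord (n * s) q" using assms pos cop by (intro ord_mult_le) auto
    finally have "s * ord n q \<le> ord (n * s) q" using pos by simp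
    moreover have "ord (n * s) q \<le> s * ord n q" using assms pos cop by (intro ord_mult_le) auto
    ultimately show ?thesis by simp
  qed
  have prm: "p dvd n \<and> \<not> p dvd (q ^ ord n q - 1) div n" if "prime p" "p dvd t" for p
  proof -
    have "coprime p q" by (rule coprime_divisors[OF that(2) dvd_refl assms(5)])
    then have "coprime (n * p) q" using assms(4) by simp
    then show ?thesis using ord_mult_prime_eq_iff[of p n q] full[of p] that assms by simp
  qed
  then show "prime p \<Longrightarrow> p dvd t \<Longrightarrow> p dvd n \<and> \<not> p dvd (q ^ ord n q - 1) div n" .
  show "gcd 4 t dvd n"
  proof (cases "4 dvd t")
    case False
    \<comment> \<open>When 4 does not divide t, the gcd is 1 or 2, and the condition for the prime 2
      suffices.\<close>
    have "gcd 4 t dvd 2"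
    proof -
      have "gcd 4 t dvd 2 ^ 2" by simp
      then obtain i where i: "i \<le> 2" "gcd 4 t = 2 ^ i"
        by (auto simp only: divides_primepow_nat[OF two_is_prime_nat])
      have "i \<noteq> 2"
      proof
        assume "i = 2"
        with i have "gcd 4 t = 4" by simp
        with False show False by (metis gcd_dvd2)
      qed
      with i have "i \<le> 1" by simp
      then show ?thesis using i by (metis le_imp_power_dvd power_one_right)
    qed
    moreover have "2 dvd n" if "2 dvd t" using prm[of 2] that by simp
    ultimately show ?thesis using False
      by (metis dvd_trans gcd_dvd2 primes_dvd_imp_eq two_is_prime_nat prime_nat_iff dvd_1_left)
  next
    case True
    define Q where "Q = q ^ ord n q"
    have "2 dvd n" using prm[of 2] True by (meson dvd_trans two_is_prime_nat even_numeral)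
    have n_dvd: "n dvd Q - 1" unfolding Q_def by (rule dvd_power_ord_minus_one[OF assms(3)])
    \<comment> \<open>Otherwise Q - 1 is 2 modulo 4, since n is and (Q - 1) / n is odd. Then 4
      divides Q + 1, so 4 n divides Q^2 - 1 and ord(q; 4 n) divides 2 ord(q; n), whereas
      \<open>full\<close> makes it 4 ord(q; n).\<close>
    have "4 dvd n"
    proof (rule ccontr)
      assume "\<not> 4 dvd n"
      have "\<not> 2 dvd (Q - 1) div n" using prm[of 2] True by (auto simp: Q_def intro: dvd_trans)
      then have "\<not> 4 dvd Q - 1"
      proof -
        obtain k where k: "n = 2 * k" using \<open>2 dvd n\<close> by blast
        obtain j where j: "Q - 1 = n * j" using n_dvd by blast
        have "odd k" using k \<open>\<not> 4 dvd n\<close> by (auto elim!: evenE)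
        moreover have "odd j" using \<open>\<not> 2 dvd (Q - 1) div n\<close> j assms(1) by simp
        ultimately have "odd (k * j)" by simp
        then have "\<not> 2 * 2 dvd 2 * (k * j)" by simp
        then show ?thesis using j k by (simp add: mult.assoc)
      qed
      moreover have "2 dvd Q - 1" using \<open>2 dvd n\<close> n_dvd by (rule dvd_trans)
      moreover have "Q > 0" using assms by (simp add: Q_def)
      ultimately have "4 dvd Q + 1" by presburger
      then have "n * 4 dvd (Q - 1) * (Q + 1)" using n_dvd by (intro mult_dvd_mono)
      also have "(Q - 1) * (Q + 1) = q ^ (ord n q * 2) - 1"
        using power_minus_one_mult_sum[OF assms(3), of "ord n q" 2]
        by (simp add: Q_def numeral_2_eq_2)
      finally have "ord (n * 4) q dvd ord n q * 2"
        using ord_dvd_iff_dvd[OF assms(3)] by blast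
      then have "4 * ord n q dvd ord n q * 2" using full[OF True] by simp
      moreover have "ord n q > 0" using assms by simp
      ultimately show False by (auto dest: dvd_imp_le)
    qed
    then show ?thesis by (meson dvd_trans gcd_dvd1)
  qed
qed

text \<open>Here m stands for the degree of f, which bounds the order by
  \<open>ord_le_degree\<close>. Since ord(q; n t) \<le> t ord(q; n), the left side forces m to be
  the order itself, and the two preceding lemmas apply.\<close>

theorem ord_mult_eq_iff:
  fixes n t q m :: nat
  assumes "n > 0" "t > 0" "q > 0" "coprime n q" "ord n q \<le> m"
  shows "coprime t q \<and> ord (n * t) q = m * t \<longleftrightarrow>
    ord n q = m \<and> gcd 4 t dvd n \<and>
    (\<forall>p. prime p \<and> p dvd t \<longrightarrow> p dvd n \<and> \<not> p dvd (q ^ m - 1) div n)"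
    (is "?L \<longleftrightarrow> ?R")
proof
  assume L: ?L
  then have "m * t \<le> t * ord n q" using assms ord_mult_le[of n t q] by simp
  then have m: "m = ord n q" using assms by simp
  then have eq: "coprime t q" "ord (n * t) q = t * ord n q" using L by (simp_all add: mult.commute)
  show ?R unfolding m using ord_mult_eq_imp[OF assms(1-4) eq] by blast
next
  assume R: ?R
  then have "coprime t q \<and> ord (n * t) q = t * ord n q"
    using ord_mult_eq[OF assms(1-4)] by blast
  then show ?L using R by (simp add: mult.commute)
qed

section \<open>The modulus q^m - 1\<close>

text \<open>The order d divides m, and q^m - 1 divides q^d - 1, which excludes d < m by
  size.\<close>

lemma ord_power_minus_one:
  fixes q m :: nat
  assumes "q > 1" "m > 0"
  shows "ord (q ^ m - 1) q = m"
proof (rule antisym)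
  have dvd: "ord (q ^ m - 1) q dvd m" using assms by (subst ord_dvd_iff_dvd) auto
  then show "ord (q ^ m - 1) q \<le> m" using assms by (intro dvd_imp_le)
  define d where "d = ord (q ^ m - 1) q"
  have "d > 0" unfolding d_def by (rule dvd_pos_nat[OF assms(2) dvd])
  then have "q ^ d > 1" using assms by (intro one_less_power)
  moreover have "q ^ m - 1 dvd q ^ d - 1" unfolding d_def using assms by (intro dvd_power_ord_minus_one) simp
  ultimately have "q ^ m - 1 \<le> q ^ d - 1" by (intro dvd_imp_le) simp_all
  then have "q ^ m \<le> q ^ d" using \<open>q ^ d > 1\<close> by linarith
  then show "m \<le> ord (q ^ m - 1) q" using assms by (simp add: d_def)
qed

lemma prod_primes_dvd_iff:
  fixes n :: nat
  assumes "finite A" "\<And>p. p \<in> A \<Longrightarrow> prime p"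
  shows "(\<Prod>p\<in>A. p) dvd n \<longleftrightarrow> (\<forall>p\<in>A. p dvd n)"
  using assms
proof (induction A rule: finite_induct)
  case (insert a A)
  have "coprime a (\<Prod>p\<in>A. p)"
    using insert by (intro prod_coprime_right) (metis insertCI primes_coprime)
  then have "a * (\<Prod>p\<in>A. p) dvd n \<longleftrightarrow> a dvd n \<and> (\<Prod>p\<in>A. p) dvd n"
    by (meson divides_mult dvd_mult_left dvd_mult_right)
  then show ?case using insert by simp
qed simp

text \<open>The factors are pairwise coprime, so their product divides n iff each of them does. The
  prime 2 is missing from the product, but for even t it divides gcd(4, t).\<close>

lemma gcd_4_mult_odd_prime_divisors_dvd_iff:
  fixes t n :: nat
  assumes "t > 0"
  shows "gcd t 4 * (\<Prod>p\<in>{p. prime p \<and> odd p \<and> p dvd t}. p) dvd n \<longleftrightarrow>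
    gcd 4 t dvd n \<and> (\<forall>p. prime p \<and> p dvd t \<longrightarrow> p dvd n)"
proof -
  define A where "A = {p. prime p \<and> odd p \<and> p dvd t}"
  have fin: "finite A" by (rule finite_subset[OF _ finite_divisors_nat[OF assms]]) (auto simp: A_def)
  have cop: "coprime (gcd t 4) (\<Prod>p\<in>A. p)"
  proof (rule prod_coprime_right)
    fix p assume "p \<in> A"
    then have "coprime 2 p" by (simp add: A_def)
    then have "coprime (2 * 2) p" by (simp only: coprime_mult_left_iff)
    then have "coprime 4 p" by simp
    then show "coprime (gcd t 4) p" by (rule coprime_divisors[OF gcd_dvd2 dvd_refl])
  qed
  have "gcd t 4 * (\<Prod>p\<in>A. p) dvd n \<longleftrightarrow> gcd 4 t dvd n \<and> (\<Prod>p\<in>A. p) dvd n"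
    using cop by (metis divides_mult dvd_mult_left dvd_mult_right gcd.commute)
  also have "\<dots> \<longleftrightarrow> gcd 4 t dvd n \<and> (\<forall>p\<in>A. p dvd n)"
    by (subst prod_primes_dvd_iff[OF fin]) (auto simp: A_def)
  also have "\<dots> \<longleftrightarrow> gcd 4 t dvd n \<and> (\<forall>p. prime p \<and> p dvd t \<longrightarrow> p dvd n)"
  proof -
    have "2 dvd n" if "gcd 4 t dvd n" "2 dvd t"
      using that by (meson dvd_trans gcd_greatest even_numeral)
    moreover have "p = 2" if "prime p" "even p" for p :: nat
      using that primes_dvd_imp_eq two_is_prime_nat by blast
    ultimately show ?thesis by (auto simp: A_def)
  qed
  finally show ?thesis by (simp add: A_def)
qed

text \<open>For n = q^m - 1 the quotient (q^m - 1) / n is 1, which no prime divides, so only the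
  divisibility conditions on n remain.\<close>

lemma ord_power_minus_one_mult_iff:
  fixes q m t :: nat
  assumes "q > 1" "m > 0" "t > 0"
  shows "coprime t q \<and> ord ((q ^ m - 1) * t) q = m * t \<longleftrightarrow>
    gcd t 4 * (\<Prod>p\<in>{p. prime p \<and> odd p \<and> p dvd t}. p) dvd q ^ m - 1"
proof -
  let ?n = "q ^ m - 1"
  have "q ^ m > 1" using assms by (intro one_less_power)
  then have n: "?n > 0" by simp
  have ord: "ord ?n q = m" by (rule ord_power_minus_one[OF assms(1,2)])
  then have "coprime ?n q" using assms(2) by (metis ord_gt_0_iff)
  then have "coprime t q \<and> ord (?n * t) q = m * t \<longleftrightarrow>
    gcd 4 t dvd ?n \<and> (\<forall>p. prime p \<and> p dvd t \<longrightarrow> p dvd ?n \<and> \<not> p dvd ?n div ?n)"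
    using ord_mult_eq_iff[OF n assms(3), of q m] ord assms(1) by simp
  also have "\<dots> \<longleftrightarrow> gcd 4 t dvd ?n \<and> (\<forall>p. prime p \<and> p dvd t \<longrightarrow> p dvd ?n)"
    using n by (metis div_self less_not_refl not_prime_unit)
  finally show ?thesis using gcd_4_mult_odd_prime_divisors_dvd_iff[OF assms(3)] by blast
qed

section \<open>Roots of polynomials over a finite field\<close>

text \<open>The exponent k ensures that the minimum in \<open>mult_order\<close> exists, which can
  fail in an infinite field.\<close>

lemma power_eq_1_iff_mult_order_dvd:
  fixes w :: "'a::field"
  assumes "k > 0" "w ^ k = 1"
  shows mult_order_pos: "mult_order w > 0"
    and power_eq_1_iff: "\<And>n. w ^ n = 1 \<longleftrightarrow> mult_order w dvd n"
proof -
  have *: "mult_order w > 0 \<and> w ^ mult_order w = 1"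
    unfolding mult_order_def by (rule LeastI[of _ k]) (use assms in auto)
  then show "mult_order w > 0" by simp
  fix n
  show "w ^ n = 1 \<longleftrightarrow> mult_order w dvd n"
  proof
    assume "w ^ n = 1"
    moreover have "w ^ n = (w ^ mult_order w) ^ (n div mult_order w) * w ^ (n mod mult_order w)"
      by (metis mult_div_mod_eq power_add power_mult)
    ultimately have "w ^ (n mod mult_order w) = 1" using * by simp
    moreover have "n mod mult_order w < mult_order w" using * by simp
    ultimately have "n mod mult_order w = 0"
      using not_less_Least[of "n mod mult_order w" "\<lambda>n. n > 0 \<and> w ^ n = 1"]
      by (simp add: mult_order_def)
    then show "mult_order w dvd n" by (rule mod_0_imp_dvd)
  next
    assume "mult_order w dvd n"
    then show "w ^ n = 1" using * by (elim dvdE) (simp add: power_mult)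
  qed
qed

lemma mult_order_eqI:
  fixes w :: "'a::field"
  assumes "n > 0" "\<And>k. w ^ k = 1 \<longleftrightarrow> n dvd k"
  shows "mult_order w = n"
  unfolding mult_order_def
  by (rule Least_equality) (use assms in \<open>auto dest: dvd_imp_le\<close>)

lemma mult_order_1: "mult_order (1 :: 'a::field) = 1"
  by (rule mult_order_eqI) auto

text \<open>Multiplication by x permutes the non-zero elements; compare their products before and
  after.\<close>

lemma finite_field_power_card_minus_1:
  fixes x :: "'a::{field,finite}"
  assumes "x \<noteq> 0"
  shows "x ^ (card (UNIV :: 'a set) - 1) = 1"
proof -
  let ?U = "UNIV - {0 :: 'a}"
  have "bij_betw ((*) x) ?U ?U"
    by (rule bij_betwI[where g = "\<lambda>y. y / x"]) (use assms in auto)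
  then have "(\<Prod>y\<in>?U. y) = (\<Prod>y\<in>?U. x * y)"
    by (rule prod.reindex_bij_betw[symmetric])
  also have "\<dots> = x ^ card ?U * (\<Prod>y\<in>?U. y)" by (simp add: prod.distrib)
  finally have "x ^ card ?U = 1" by simp
  then show ?thesis by (simp add: card_Diff_singleton)
qed

text \<open>The order of z is a multiple of n dividing n p, so it is n or n p; the last hypothesis
  excludes n.\<close>

lemma mult_order_power_prime_root:
  fixes z :: "'a::field"
  assumes "prime p" "n > 0" "mult_order (z ^ p) = n" "(z ^ p) ^ n = 1" "\<not> mult_order z dvd n"
  shows "mult_order z = n * p"
proof -
  have "z ^ (p * n) = 1" using assms(4) by (simp add: power_mult)
  then have iff: "z ^ k = 1 \<longleftrightarrow> mult_order z dvd k" for k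
    using assms(1,2) prime_gt_0_nat by (intro power_eq_1_iff) auto
  have iff': "(z ^ p) ^ k = 1 \<longleftrightarrow> n dvd k" for k
    using power_eq_1_iff[OF assms(2,4)] assms(3) by simp
  have "n dvd mult_order z" using iff'[of "mult_order z"] iff[of "p * mult_order z"] by (simp add: power_mult)
  moreover have "mult_order z dvd n * p" using \<open>z ^ (p * n) = 1\<close> iff by (simp add: mult.commute)
  ultimately obtain e where e: "mult_order z = n * e" "e dvd p"
    using assms(2) by (metis dvd_def nat_mult_dvd_cancel1)
  then have "e = 1 \<or> e = p" using assms(1) prime_nat_iff by blast
  then show ?thesis using e assms(5) by auto
qed

lemma CHAR_poly: "CHAR('a::comm_semiring_1 poly) = CHAR('a)"
  by (rule CHAR_eqI) (simp_all add: of_nat_poly of_nat_eq_0_iff_char_dvd)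

section \<open>The Frobenius map in an algebraically closed extension\<close>

text \<open>\<open>h\<close> stays general because it serves both for the closure of the base field
  and for the closure of a given finite extension.\<close>

locale finite_field_closure = field_hom h
  for h :: "'a::{field,finite} \<Rightarrow> 'k::alg_closed_field" +
  fixes q :: nat
  assumes card_eq: "card (UNIV :: 'a set) = q" and primepow: "primepow q"
begin

interpretation map_hom: map_poly_inj_idom_hom h ..

lemma q_gt_1: "q > 1"
  using primepow primepow_gt_Suc_0 by fastforce

lemma base_power_q: "c ^ q = (c :: 'a)"
proof (cases "c = 0")
  case False
  have "c ^ Suc (q - 1) = c" using finite_field_power_card_minus_1[OF False] card_eq by simp
  then show ?thesis using q_gt_1 by simp
qed (use q_gt_1 in auto)

lemma base_power_q_power: "c ^ (q ^ i) = (c :: 'a)"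
  by (induction i) (auto simp: power_mult base_power_q)

lemma prime_CHAR_base: "prime CHAR('a)"
  using prime_CHAR_semidom[where ?'a = 'a] finite_imp_CHAR_pos[where ?'a = 'a] by simp

text \<open>The characteristic divides the cardinality, so it is the prime of which \<open>q\<close>
  is a power.\<close>

lemma q_eq_CHAR_power: "\<exists>k>0. q = CHAR('a) ^ k"
proof -
  obtain p k where pk: "prime p" "k > 0" "q = p ^ k" using primepow by (auto simp: primepow_def)
  have "CHAR('a) dvd p ^ k" using CHAR_dvd_CARD[where ?'a = 'a] card_eq pk by simp
  then have "CHAR('a) dvd p" using prime_CHAR_base by (rule prime_dvd_power_nat[rotated])
  then have "CHAR('a) = p" using pk(1) prime_CHAR_base primes_dvd_imp_eq by blast
  then show ?thesis using pk by blast
qed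

lemma CHAR_ext: "CHAR('k) = CHAR('a)"
proof (rule CHAR_eqI)
  have "of_nat n = h (of_nat n)" for n by (induction n) (auto simp: hom_distribs)
  then have eq: "of_nat n = (0 :: 'k) \<longleftrightarrow> of_nat n = (0 :: 'a)" for n by simp
  show "of_nat CHAR('a) = (0 :: 'k)" by (simp add: eq)
  show "CHAR('a) dvd n" if "of_nat n = (0 :: 'k)" for n
    using that by (simp add: eq of_nat_eq_0_iff_char_dvd)
qed

lemma power_q_power_sum: "(\<Sum>x\<in>A. f x :: 'k) ^ (q ^ i) = (\<Sum>x\<in>A. f x ^ (q ^ i))"
proof -
  obtain k where "q = CHAR('k) ^ k" using q_eq_CHAR_power CHAR_ext by auto
  then show ?thesis
    by (intro freshmans_dream_sum'[of _ "k * i"]) (simp_all add: prime_CHAR_base CHAR_ext power_mult)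
qed

text \<open>Taking q-th powers is additive in the extension and fixes the coefficients of f, so it
  commutes with evaluation.\<close>

lemma poly_power_q_power:
  "poly (map_poly h f) (x ^ (q ^ i)) = poly (map_poly h f) x ^ (q ^ i)"
proof -
  have "h (coeff f j) = h (coeff f j) ^ (q ^ i)" for j
    by (metis base_power_q_power hom_power)
  then show ?thesis
    by (simp add: poly_altdef power_q_power_sum power_mult_distrib flip: power_mult)
       (simp add: mult.commute)
qed

text \<open>If the order were p j with p the characteristic, then (w^j - 1)^p = w^(p j) - 1 = 0, so
  w^j = 1 already.\<close>

lemma coprime_mult_order:
  fixes w :: 'k
  assumes "k > 0" "w ^ k = 1"
  shows "coprime (mult_order w) q"
proof (rule ccontr)
  define p where "p = CHAR('k)"
  have p: "prime p" using prime_CHAR_base CHAR_ext by (simp add: p_def)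
  assume "\<not> coprime (mult_order w) q"
  then have "\<not> coprime (mult_order w) p" using q_eq_CHAR_power CHAR_ext p_def by auto
  then have "p dvd mult_order w" using p by (metis coprime_commute prime_imp_coprime)
  then obtain j where j: "mult_order w = p * j" by blast
  have "w ^ (p * j) = 1" using power_eq_1_iff[OF assms] j by simp
  then have "(w ^ j) ^ p = 1" by (simp add: mult.commute flip: power_mult)
  moreover have "((w ^ j - 1) + 1) ^ p = (w ^ j - 1) ^ p + 1 ^ p"
    by (rule freshmans_dream) (use p p_def in auto)
  ultimately have "w ^ j = 1" using prime_gt_0_nat[OF p] by simp
  then have "p * j dvd j" using power_eq_1_iff[OF assms] j by simp
  moreover have "j > 0" using mult_order_pos[OF assms] j by simp
  ultimately show False using prime_gt_1_nat[OF p] by (auto dest: dvd_imp_le)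
qed

section \<open>Degrees of polynomials vanishing at w\<close>

text \<open>The conjugates of w under the Frobenius map are roots of every polynomial that has w as a root.\<close>

lemma ord_le_degree:
  fixes w :: 'k
  assumes "k > 0" "w ^ k = 1" "f \<noteq> 0" "poly (map_poly h f) w = 0"
  shows "ord (mult_order w) q \<le> degree f"
proof -
  define n where "n = mult_order w"
  have n: "n > 0" "coprime n q" using mult_order_pos coprime_mult_order assms by (auto simp: n_def)
  have iff: "w ^ i = 1 \<longleftrightarrow> n dvd i" for i using power_eq_1_iff[OF assms(1,2)] by (simp add: n_def)
  have "w \<noteq> 0" using assms by (auto simp: power_0_left)
  \<comment> \<open>Equal conjugates give q^i = q^j modulo n, so i and j agree modulo ord(q;
    n).\<close>
  have inj: "inj_on (\<lambda>i. w ^ (q ^ i)) {..<ord n q}"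
  proof (rule linorder_inj_onI)
    fix i j assume ij: "i < j" "j \<in> {..<ord n q}"
    show "w ^ (q ^ i) \<noteq> w ^ (q ^ j)"
    proof
      assume eq: "w ^ (q ^ i) = w ^ (q ^ j)"
      have le: "q ^ i \<le> q ^ j" using ij q_gt_1 by (simp add: power_increasing)
      then have "w ^ (q ^ j) = w ^ (q ^ i) * w ^ (q ^ j - q ^ i)" by (simp flip: power_add)
      then have "w ^ (q ^ j - q ^ i) = 1" using eq \<open>w \<noteq> 0\<close> by simp
      then have "[q ^ j = q ^ i] (mod n)" using iff le by (simp add: cong_altdef_nat)
      then have "[j = i] (mod ord n q)" using order_divides_expdiff[OF n(2)] by simp
      then show False using ij by (auto simp: cong_def)
    qed
  qed auto
  have nz: "map_poly h f \<noteq> 0" using assms(3) by simp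
  have "ord n q = card ((\<lambda>i. w ^ (q ^ i)) ` {..<ord n q})" using inj by (simp add: card_image)
  also have "\<dots> \<le> card {x. poly (map_poly h f) x = 0}"
    by (rule card_mono) (use poly_roots_finite[OF nz] assms(4) q_gt_1 in \<open>auto simp: poly_power_q_power\<close>)
  also have "\<dots> \<le> degree (map_poly h f)" by (rule card_poly_roots_bound[OF nz])
  finally show ?thesis by (simp add: n_def)
qed

text \<open>A pigeonhole argument with d = ord(q; n), n the order of w. There are q^(d + 1)
  polynomials of degree at most d, but their values at w all satisfy x^(q^d) = x, which has at most
  q^d solutions. The difference of two polynomials that agree at w is the witness.\<close>

lemma exists_annihilator:
  fixes w :: 'k
  assumes "k > 0" "w ^ k = 1"
  shows "\<exists>g. g \<noteq> 0 \<and> degree g \<le> ord (mult_order w) q \<and> poly (map_poly h g) w = 0"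
proof -
  define n where "n = mult_order w"
  define d where "d = ord n q"
  have n: "n > 0" "coprime n q" using mult_order_pos coprime_mult_order assms by (auto simp: n_def)
  then have "d > 0" by (simp add: d_def)
  have qd: "q ^ d > 1" using q_gt_1 \<open>d > 0\<close> by (rule one_less_power)
  define V where "V = {x :: 'k. x ^ (q ^ d) = x}"
  have V_eq: "V = {x. poly (monom 1 (q ^ d) - monom 1 1) x = 0}" by (auto simp: V_def poly_monom)
  have nz: "monom 1 (q ^ d) - monom 1 1 \<noteq> (0 :: 'k poly)"
    using \<open>d > 0\<close> q_gt_1 by (simp add: monom_eq_iff')
  have "finite V" using poly_roots_finite[OF nz] V_eq by simp
  have "card V \<le> degree (monom 1 (q ^ d) - monom 1 1 :: 'k poly)"
    unfolding V_eq by (rule card_poly_roots_bound[OF nz])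
  also have "\<dots> \<le> q ^ d" using qd by (intro degree_diff_le) (auto simp: degree_monom_eq)
  finally have card_V: "card V \<le> q ^ d" .
  define C where "C = PiE {..d} (\<lambda>_. UNIV :: 'a set)"
  define ev where "ev = (\<lambda>c. \<Sum>i\<le>d. h (c i) * w ^ i)"
  \<comment> \<open>As n divides q^d - 1, taking q^d-th powers fixes w and with it every value
    \<open>ev c\<close>.\<close>
  have "w ^ (q ^ d) = w"
  proof -
    have "w ^ (q ^ d - 1) = 1"
      using power_eq_1_iff[OF assms] dvd_power_ord_minus_one[of q n] q_gt_1 by (simp add: n_def d_def)
    moreover have "q ^ d > 0" using qd by linarith
    ultimately show ?thesis using power_minus_mult[of "q ^ d" w] by (metis mult_1)
  qed
  then have "ev c \<in> V" for c
    unfolding ev_def V_def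
    by (simp add: power_q_power_sum power_mult_distrib base_power_q_power flip: hom_power)
       (metis (no_types, lifting) power_mult mult.commute)
  moreover have "card C = q ^ Suc d" unfolding C_def by (simp add: card_PiE card_eq)
  moreover have "q ^ d < q ^ Suc d" by (rule power_strict_increasing) (use q_gt_1 in simp_all)
  ultimately have "\<not> card C \<le> card V" using card_V by linarith
  then have "\<not> inj_on ev C"
    using card_inj_on_le[of ev C V] \<open>finite V\<close> \<open>\<And>c. ev c \<in> V\<close> by blast
  then obtain c c' where c: "c \<in> C" "c' \<in> C" "c \<noteq> c'" "ev c = ev c'" by (auto simp: inj_on_def)
  define g where "g = (\<Sum>i\<le>d. monom (c i - c' i) i)"
  obtain i where i: "i \<le> d" "c i \<noteq> c' i"
    using c unfolding C_def by (metis PiE_ext atMost_iff)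
  have coeff: "coeff g j = (if j \<le> d then c j - c' j else 0)" for j
    unfolding g_def by (simp add: coeff_sum)
  have "coeff g i \<noteq> 0" using i by (simp add: coeff)
  then have "g \<noteq> 0" by auto
  moreover have "degree g \<le> d" by (rule degree_le) (simp add: coeff)
  moreover have "poly (map_poly h g) w = ev c - ev c'"
    unfolding g_def ev_def
    by (simp add: map_hom.hom_sum hom_distribs poly_sum poly_monom algebra_simps sum_subtractf)
  ultimately show ?thesis using c(4) by (auto simp: d_def n_def)
qed

text \<open>A polynomial g of least degree vanishing at w divides f, so an irreducible f has the
  degree of g, which \<open>ord_le_degree\<close> and \<open>exists_annihilator\<close> pin down.
  Conversely, the factor of f that vanishes at w uses up the whole degree.\<close>

lemma irreducible_iff_degree:
  fixes w :: 'k
  assumes "k > 0" "w ^ k = 1" "f \<noteq> 0" "poly (map_poly h f) w = 0"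
  shows "Factorial_Ring.irreducible f \<longleftrightarrow> degree f = ord (mult_order w) q"
proof
  assume irr: "Factorial_Ring.irreducible f"
  define P where "P = (\<lambda>g. g \<noteq> 0 \<and> poly (map_poly h g) w = 0)"
  define g where "g = arg_min degree P"
  obtain g' where g': "P g'" "degree g' \<le> ord (mult_order w) q"
    using exists_annihilator[OF assms(1,2)] by (auto simp: P_def)
  have g: "P g" unfolding g_def by (rule arg_min_natI[where P = P and k = g', OF g'(1)])
  have g_min: "degree g \<le> degree u" if "P u" for u
    unfolding g_def by (rule arg_min_nat_le[where P = P, OF that])
  have "f mod g = 0"
  proof (rule ccontr)
    assume nz: "f mod g \<noteq> 0"
    have "poly (map_poly h (f div g * g + f mod g)) w = 0" using assms(4) by simp
    then have "P (f mod g)"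
      using nz g unfolding P_def map_poly_hom_add map_hom.hom_mult poly_add poly_mult by simp
    then show False using g_min nz g degree_mod_less'[of g f] by (force simp: P_def)
  qed
  then obtain c where c: "f = g * c" by blast
  have "\<not> is_unit g"
  proof
    assume "is_unit g"
    then have "degree g = 0" using g is_unit_iff_degree[of g] by (simp add: P_def)
    then obtain a where "g = [:a:]" by (rule degree_eq_zeroE)
    then show False using g by (simp add: P_def hom_distribs)
  qed
  then have "is_unit c" using Factorial_Ring.irreducibleD[OF irr c] by blast
  then have "degree c = 0" using assms(3) c is_unit_iff_degree[of c] by simp
  then have "degree f = degree g" using c assms(3) by (simp add: degree_mult_eq)
  then show "degree f = ord (mult_order w) q"
    using ord_le_degree[OF assms] g_min[OF g'(1)] g'(2) by simp
next
  assume deg: "degree f = ord (mult_order w) q"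
  have "coprime (mult_order w) q" by (rule coprime_mult_order[OF assms(1,2)])
  then have pos: "degree f > 0" by (simp add: deg)
  show "Factorial_Ring.irreducible f"
  proof (rule Factorial_Ring.irreducibleI)
    show "\<not> is_unit f" using pos assms(3) by (simp add: is_unit_iff_degree)
    have unit: "is_unit v" if "f = u * v" "poly (map_poly h u) w = 0" for u v
    proof -
      have nz: "u \<noteq> 0" "v \<noteq> 0" using that assms(3) by auto
      have "ord (mult_order w) q \<le> degree u"
        by (rule ord_le_degree[OF assms(1,2) nz(1) that(2)])
      then have "degree v = 0" using deg that nz by (simp add: degree_mult_eq)
      then show ?thesis using nz by (simp add: is_unit_iff_degree)
    qed
    fix u v assume uv: "f = u * v"
    then have "poly (map_poly h u) w = 0 \<or> poly (map_poly h v) w = 0"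
      using assms(4) by (simp add: hom_distribs)
    then show "is_unit u \<or> is_unit v"
      using unit[of u v] unit[of v u] uv by (auto simp: mult.commute)
  qed (rule assms(3))
qed

section \<open>Roots of prescribed order\<close>

text \<open>By \<open>mult_order_power_prime_root\<close> it is enough to find a p-th root of w
  whose order does not divide the order n of w.\<close>

lemma exists_prime_root:
  fixes w :: 'k
  assumes "prime p" "coprime p q" "k > 0" "w ^ k = 1"
  shows "\<exists>z. z ^ p = w \<and> mult_order z = mult_order w * p"
proof -
  define n where "n = mult_order w"
  have "n > 0" using mult_order_pos[OF assms(3,4)] by (simp add: n_def)
  have iff: "w ^ i = 1 \<longleftrightarrow> n dvd i" for i using power_eq_1_iff[OF assms(3,4)] by (simp add: n_def)
  have p: "p > 0" using assms(1) by (rule prime_gt_0_nat)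
  obtain z where z: "z ^ p = w" using nth_root_exists[OF p] by blast
  \<comment> \<open>If the order of z divides n, then that of z e does not.\<close>
  obtain e :: 'k where e: "e ^ p = 1" "e \<noteq> 1"
  proof -
    let ?f = "\<lambda>i::nat. 1 :: 'k"
    have "p - 1 > 0" using prime_gt_1_nat[OF assms(1)] by simp
    then obtain e :: 'k where "(\<Sum>i\<le>p - 1. 1 * e ^ i) = 0" using alg_closed[of "p - 1" ?f] by auto
    moreover have "{..p - 1} = {..<p}" using p by auto
    ultimately have sum: "(\<Sum>i<p. e ^ i) = 0" by simp
    have "e ^ p - 1 = (e - 1) * (\<Sum>i<p. e ^ i)" by (rule power_diff_1_eq)
    then have "e ^ p = 1" using sum by simp
    moreover have "e \<noteq> 1"
    proof
      assume "e = 1"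
      then have "of_nat p = (0 :: 'k)" using sum by simp
      then have "CHAR('a) dvd p" using CHAR_ext by (simp add: of_nat_eq_0_iff_char_dvd)
      then have "CHAR('a) = p" using assms(1) prime_CHAR_base primes_dvd_imp_eq by blast
      then have "p dvd q" using q_eq_CHAR_power by (auto intro: dvd_power)
      then show False using assms(1,2) by (metis coprime_absorb_left not_prime_unit)
    qed
    ultimately show ?thesis using that by blast
  qed
  have "\<exists>z. z ^ p = w \<and> \<not> mult_order z dvd n"
  proof (cases "mult_order z dvd n")
    case True
    have pos: "p * n > 0" using p \<open>n > 0\<close> by simp
    have wn: "w ^ n = 1" using iff by simp
    have "z ^ (p * n) = 1" using z wn by (simp add: power_mult)
    then have zn: "z ^ n = 1" using power_eq_1_iff[OF pos] True by blast
    have "(z * e) ^ p = w" using z e by (simp add: power_mult_distrib)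
    then have zen: "(z * e) ^ (p * n) = 1" using wn by (simp add: power_mult)
    have "\<not> mult_order (z * e) dvd n"
    \<comment> \<open>If p divides n, then z^n = 1 gives w^(n / p) = 1, which is absurd. Otherwise e
      has order p, so (z e)^n = e^n is not 1.\<close>
    proof (cases "p dvd n")
      case True
      then obtain j where j: "n = p * j" by blast
      have "w ^ j = 1" using zn z j by (simp add: power_mult)
      then have "n dvd j" using iff by simp
      then show ?thesis using j \<open>n > 0\<close> prime_gt_1_nat[OF assms(1)] by (auto dest: dvd_imp_le)
    next
      case False
      have "coprime p n" using assms(1) False by (rule prime_imp_coprime)
      have ep: "e ^ i = 1 \<longleftrightarrow> mult_order e dvd i" for i by (rule power_eq_1_iff[OF p e(1)])
      have "mult_order e = p"
        using ep[of p] ep[of 1] e assms(1) prime_nat_iff by auto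
      then have "e ^ n \<noteq> 1" using ep False by simp
      then have "(z * e) ^ n \<noteq> 1" using zn by (simp add: power_mult_distrib)
      then show ?thesis using power_eq_1_iff[OF pos zen] by simp
    qed
    then show ?thesis using \<open>(z * e) ^ p = w\<close> by blast
  qed (use z in blast)
  then obtain z where z: "z ^ p = w" "\<not> mult_order z dvd n" by blast
  have "mult_order z = n * p"
    by (rule mult_order_power_prime_root[OF assms(1) \<open>n > 0\<close>]) (use z iff n_def in auto)
  then show ?thesis using z n_def by blast
qed

lemma exists_root_of_order:
  fixes w :: 'k
  assumes "t > 0" "coprime t q" "k > 0" "w ^ k = 1"
  shows "\<exists>z. z ^ t = w \<and> mult_order z = mult_order w * t"
  using assms
proof (induction t arbitrary: w k rule: less_induct)
  case (less t)
  show ?case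
  proof (cases "t = 1")
    case False
    then obtain p s where p: "prime p" "t = p * s"
      using prime_factor_nat by (metis dvdE)
    then have s: "s > 0" "s < t" "coprime s q" "coprime p q"
      using less.prems prime_gt_1_nat[of p] by auto
    obtain y where y: "y ^ p = w" "mult_order y = mult_order w * p"
      using exists_prime_root[OF p(1) s(4) less.prems(3,4)] by blast
    have yk: "y ^ (p * k) = 1" using y less.prems by (simp add: power_mult)
    have "p * k > 0" using p less.prems by (simp add: prime_gt_0_nat)
    then obtain z where z: "z ^ s = y" "mult_order z = mult_order y * s"
      using less.IH[OF s(2,1,3) _ yk] by blast
    have "z ^ t = w" using z y p by (metis power_mult mult.commute)
    moreover have "mult_order z = mult_order w * t" using z y p by (simp add: mult.assoc)
    ultimately show ?thesis by blast
  qed auto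
qed

section \<open>Hyper-irreducibility and orders\<close>

lemma coprime_of_hyper_irreducible:
  fixes f :: "'a poly"
  assumes "hyper_irreducible t f"
  shows "coprime t q"
proof (rule ccontr)
  define p where "p = CHAR('a)"
  have p: "prime p" using prime_CHAR_base by (simp add: p_def)
  obtain k where k: "k > 0" "q = p ^ k" using q_eq_CHAR_power by (auto simp: p_def)
  assume "\<not> coprime t q"
  then have "\<not> coprime t p" using k by simp
  then have "p dvd t" using p by (metis coprime_commute prime_imp_coprime)
  then obtain s where s: "t = p * s" by blast
  \<comment> \<open>Here r = q / p, so c^r is a p-th root of c because c^q = c.\<close>
  define r where "r = p ^ (k - 1)"
  have r: "(c ^ r) ^ p = c" for c :: 'a
  proof -
    have "r * p = q" using k unfolding r_def by (metis power_minus_mult)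
    then show ?thesis using base_power_q by (simp flip: power_mult)
  qed
  \<comment> \<open>As t = p s, dividing the exponents by p and taking p-th roots of the
    coefficients yields a p-th root of f(x^t).\<close>
  define g where "g = (\<Sum>i\<le>degree f. monom (coeff f i ^ r) (s * i))"
  have "g ^ p = (\<Sum>i\<le>degree f. monom (coeff f i ^ r) (s * i) ^ p)"
    unfolding g_def by (rule freshmans_dream_sum) (use p p_def CHAR_poly in simp_all)
  also have "\<dots> = (\<Sum>i\<le>degree f. monom (coeff f i) (t * i))"
    by (simp add: monom_power r s mult_ac)
  also have "\<dots> = f \<circ>\<^sub>p monom 1 t"
    by (simp add: pcompose_altdef poly_altdef coeff_map_poly degree_map_poly monom_power smult_monom)
  finally have g: "g ^ p = f \<circ>\<^sub>p monom 1 t" .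
  have irr: "Factorial_Ring.irreducible (g ^ p)" using assms by (simp add: g hyper_irreducible_def)
  have gp: "g ^ p = g * g ^ (p - 1)" using prime_gt_0_nat[OF p] by (simp add: power_eq_if)
  \<comment> \<open>If g is not a unit, irreducibility makes g^(p - 1) a unit, yet g divides
    it.\<close>
  have "is_unit g"
  proof (rule ccontr)
    assume nu: "\<not> is_unit g"
    then have "is_unit (g ^ (p - 1))" using Factorial_Ring.irreducibleD[OF irr gp] by blast
    moreover have "g dvd g ^ (p - 1)" using prime_gt_1_nat[OF p] by (intro dvd_power) simp
    ultimately show False using nu dvd_trans by blast
  qed
  then have "is_unit (g ^ p)" unfolding is_unit_power_iff by (rule disjI1)
  then show False using irreducible_not_unit[OF irr] by blast
qed

text \<open>Reduction modulo f writes every power of w as the value of a polynomial of degree at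
  most deg f, so two powers coincide. This supplies the exponent k for a root known only in the
  closure.\<close>

lemma power_eq_1_of_root:
  fixes w :: 'k
  assumes "f \<noteq> 0" "poly (map_poly h f) w = 0" "w \<noteq> 0"
  shows "\<exists>k>0. w ^ k = 1"
proof -
  define n where "n = degree f"
  define S where "S = (\<lambda>c. \<Sum>i\<le>n. h (c i) * w ^ i) ` PiE {..n} (\<lambda>_. UNIV :: 'a set)"
  have "finite S" unfolding S_def by (intro finite_imageI finite_PiE) auto
  have "w ^ k \<in> S" for k
  proof -
    define r where "r = monom 1 k mod f"
    have "poly (map_poly h (monom 1 k div f * f + r)) w = w ^ k"
      unfolding r_def by (simp add: poly_monom)
    then have "w ^ k = poly (map_poly h r) w"
      using assms(2) unfolding map_poly_hom_add map_hom.hom_mult poly_add poly_mult by simp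
    also have "\<dots> = (\<Sum>i\<le>degree r. h (coeff r i) * w ^ i)" by (simp add: poly_altdef)
    also have "\<dots> = (\<Sum>i\<le>n. h (coeff r i) * w ^ i)"
    proof (rule sum.mono_neutral_left)
      show "{..degree r} \<subseteq> {..n}"
        using degree_mod_less[OF assms(1), of "monom 1 k"] by (auto simp: r_def n_def)
    qed (auto simp: coeff_eq_0)
    also have "\<dots> = (\<Sum>i\<le>n. h (restrict (coeff r) {..n} i) * w ^ i)" by simp
    finally show ?thesis unfolding S_def by (rule image_eqI[where x = "restrict (coeff r) {..n}"]) simp
  qed
  then have "range (\<lambda>k. w ^ k) \<subseteq> S" by blast
  then have "finite (range (\<lambda>k. w ^ k))" using \<open>finite S\<close> by (rule finite_subset)
  then have "\<not> inj (\<lambda>k::nat. w ^ k)" using range_inj_infinite by blast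
  then obtain i j :: nat where ij: "i < j" "w ^ i = w ^ j"
    unfolding inj_def by (metis nat_neq_iff)
  then have "w ^ i * w ^ (j - i) = w ^ i" by (metis le_add_diff_inverse less_imp_le power_add)
  then have "w ^ (j - i) = 1" using assms(3) by simp
  then show ?thesis using ij by (intro exI[of _ "j - i"]) simp
qed

theorem hyper_irreducible_iff:
  fixes w :: 'k
  assumes "k > 0" "w ^ k = 1" "poly (map_poly h f) w = 0" "t > 0"
  shows "hyper_irreducible t f \<longleftrightarrow> coprime t q \<and> ord (mult_order w * t) q = degree f * t"
\<comment> \<open>Both sides fail here: f = 0 would need order 0, but orders are positive when the
  modulus is coprime to q.\<close>
proof (cases "f = 0 \<or> \<not> coprime t q")
  case True
  have "coprime (mult_order w) q" by (rule coprime_mult_order[OF assms(1,2)])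
  moreover have "\<not> hyper_irreducible t (0 :: 'a poly)" by (simp add: hyper_irreducible_def)
  ultimately show ?thesis using True coprime_of_hyper_irreducible by (auto simp: ord_eq_0)
next
  case False
  then obtain z where z: "z ^ t = w" "mult_order z = mult_order w * t"
    using exists_root_of_order[OF assms(4) _ assms(1,2)] by blast
  have zk: "t * k > 0" "z ^ (t * k) = 1" using z assms by (simp_all add: power_mult)
  let ?g = "f \<circ>\<^sub>p monom 1 t"
  have deg: "degree ?g = degree f * t" by (simp add: degree_pcompose degree_monom_eq)
  have "?g \<noteq> 0" using False assms(4) by (simp add: pcompose_eq_0_iff degree_monom_eq)
  moreover have "poly (map_poly h ?g) z = 0"
    using z assms(3) by (simp add: map_poly_pcompose poly_pcompose poly_monom)
  ultimately show ?thesis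
    using irreducible_iff_degree[OF zk, of ?g] False deg z by (auto simp: hyper_irreducible_def)
qed

text \<open>The polynomial is one of degree m vanishing at an element of order q^m - 1, a generator
  of the multiplicative group of the field with q^m elements.\<close>

lemma exists_hyper_irreducible:
  assumes "m > 0" "t > 0" "coprime t q" "ord ((q ^ m - 1) * t) q = m * t"
  shows "\<exists>f :: 'a poly. degree f = m \<and> hyper_irreducible t f"
proof -
  define n where "n = q ^ m - 1"
  have "q ^ m > 1" using q_gt_1 assms by (intro one_less_power)
  then have n: "n > 0" by (simp add: n_def)
  have ord: "ord n q = m" unfolding n_def by (rule ord_power_minus_one[OF q_gt_1 assms(1)])
  then have "coprime n q" using assms(1) by (metis ord_gt_0_iff)
  \<comment> \<open>z is an n-th root of 1; as 1 has order 1, z has order n.\<close>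
  then obtain z :: 'k where z: "z ^ n = 1" "mult_order z = n"
    using exists_root_of_order[OF n, of 1 1] by (auto simp: mult_order_1)
  obtain g where g: "g \<noteq> 0" "degree g \<le> m" "poly (map_poly h g) z = 0"
    using exists_annihilator[OF n z(1)] z(2) ord by auto
  have "degree g = m" using ord_le_degree[OF n z(1) g(1,3)] g(2) z(2) ord by simp
  moreover have "hyper_irreducible t g"
    using hyper_irreducible_iff[OF n z(1) g(3) assms(2)] z(2) assms(3,4) \<open>degree g = m\<close>
    by (simp add: n_def)
  ultimately show ?thesis by blast
qed

text \<open>A root of f has an order n dividing q^m - 1, so the divisibility conditions on n pass to
  q^m - 1, and these are all that is required for that modulus.\<close>

lemma ord_of_hyper_irreducible:
  fixes f :: "'a poly"
  assumes "degree f > 0" "t > 0" "hyper_irreducible t f"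
  shows "coprime t q \<and> ord ((q ^ degree f - 1) * t) q = degree f * t"
\<comment> \<open>For t = 1 the polynomial may be a multiple of x, whose root 0 has no
  order.\<close>
proof (cases "t = 1")
  case True
  then show ?thesis using ord_power_minus_one[OF q_gt_1 assms(1)] by simp
next
  case False
  obtain w where w: "poly (map_poly h f) w = 0"
    using alg_closed_imp_poly_has_root[of "map_poly h f"] assms(1) by auto
  have nz: "f \<noteq> 0" using assms(1) by auto
  \<comment> \<open>If 0 is a root, x divides f, so f(x^t) is x times a multiple of x^(t - 1), which
    is not a unit for t > 1.\<close>
  have "w \<noteq> 0"
  proof
    assume "w = 0"
    then have "poly f 0 = 0" using w by simp
    then have "[:0, 1:] dvd f" by (simp add: poly_eq_0_iff_dvd)
    then obtain c where c: "f = [:0, 1:] * c" by blast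
    have x: "monom 1 t = [:0, 1:] * monom (1 :: 'a) (t - 1)"
      using assms(2) by (simp add: monom_altdef flip: power_Suc)
    have "f \<circ>\<^sub>p monom 1 t = [:0, 1:] * (monom 1 (t - 1) * (c \<circ>\<^sub>p monom 1 t))"
      using c x by (simp add: pcompose_mult pcompose_pCons mult.assoc)
    then have "is_unit [:0, 1 :: 'a:] \<or> is_unit (monom 1 (t - 1) * (c \<circ>\<^sub>p monom (1 :: 'a) t))"
      using assms(3) Factorial_Ring.irreducibleD unfolding hyper_irreducible_def by blast
    moreover have "\<not> is_unit [:0, 1 :: 'a:]" by (simp add: is_unit_iff_degree)
    ultimately have "is_unit (monom (1 :: 'a) (t - 1))" using dvd_mult_left by blast
    then show False using False assms(2) by (simp add: is_unit_iff_degree degree_monom_eq)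
  qed
  obtain k where k: "k > 0" "w ^ k = 1" using power_eq_1_of_root[OF nz w \<open>w \<noteq> 0\<close>] by blast
  define n where "n = mult_order w"
  define m where "m = degree f"
  have n: "n > 0" "coprime n q" using mult_order_pos[OF k] coprime_mult_order[OF k] by (simp_all add: n_def)
  have "coprime t q \<and> ord (n * t) q = m * t"
    using hyper_irreducible_iff[OF k w assms(2)] assms(3) by (simp add: n_def m_def)
  moreover have "ord n q \<le> m" using ord_le_degree[OF k nz w] by (simp add: n_def m_def)
  ultimately have *: "ord n q = m" "gcd 4 t dvd n" "\<forall>p. prime p \<and> p dvd t \<longrightarrow> p dvd n"
    using ord_mult_eq_iff[OF n(1) assms(2) _ n(2)] q_gt_1 by auto
  have "n dvd q ^ m - 1" using dvd_power_ord_minus_one[of q n] q_gt_1 * by simp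
  then have "gcd 4 t dvd q ^ m - 1 \<and> (\<forall>p. prime p \<and> p dvd t \<longrightarrow> p dvd q ^ m - 1)"
    using * dvd_trans by blast
  then show ?thesis
    using ord_power_minus_one_mult_iff[OF q_gt_1 assms(1,2)]
      gcd_4_mult_odd_prime_divisors_dvd_iff[OF assms(2)] by (simp add: m_def)
qed

end

section \<open>Transfer between finite fields and their closures\<close>

lemma field_hom_to_ac: "field_hom (to_ac :: 'a::field \<Rightarrow> _)"
  by unfold_locales auto

theorem corollary3p2:
  fixes q :: nat
  assumes "primepow q"
    and "card (UNIV :: 'a::{field,finite} set) = q"
  shows
    "(\<forall>(h :: 'a \<Rightarrow> 'b::{field,finite}) (f :: 'a poly) (\<omega> :: 'b) (t :: nat) (m :: nat).
        ext_root h f \<omega> \<and> \<omega> \<noteq> 0 \<and> t > 0 \<and> m = degree f \<longrightarrow>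
          (hyper_irreducible t f \<longleftrightarrow>
             coprime t q \<and> ord (mult_order \<omega> * t) q = m * t) \<and>
          (coprime t q \<and> ord (mult_order \<omega> * t) q = m * t \<longleftrightarrow>
             ord (mult_order \<omega>) q = m \<and> gcd 4 t dvd mult_order \<omega> \<and>
             (\<forall>p. prime p \<and> p dvd t \<longrightarrow>
                p dvd mult_order \<omega> \<and> \<not> p dvd (q ^ m - 1) div mult_order \<omega>))) \<and>
     (\<forall>(m :: nat) (t :: nat). m > 0 \<and> t > 0 \<longrightarrow>
          ((\<exists>f :: 'a poly. degree f = m \<and> hyper_irreducible t f) \<longleftrightarrow>
             coprime t q \<and> ord ((q ^ m - 1) * t) q = m * t) \<and>
          (coprime t q \<and> ord ((q ^ m - 1) * t) q = m * t \<longleftrightarrow>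
             gcd t 4 * (\<Prod>p\<in>{p. prime p \<and> odd p \<and> p dvd t}. p) dvd q ^ m - 1))"
proof (rule conjI; intro allI impI)
  fix h :: "'a \<Rightarrow> 'b" and f :: "'a poly" and \<omega> :: 'b and t m :: nat
  assume "ext_root h f \<omega> \<and> \<omega> \<noteq> 0 \<and> t > 0 \<and> m = degree f"
  then have h: "field_hom h" and root: "poly (map_poly h f) \<omega> = 0" and "\<omega> \<noteq> 0" "t > 0"
    and m: "m = degree f"
    by (simp_all add: ext_root_def)
  interpret h: field_hom h by (rule h)
  interpret ac: field_hom "to_ac :: 'b \<Rightarrow> _" by (rule field_hom_to_ac)
  \<comment> \<open>The given extension is embedded in its own closure; \<open>to_ac\<close> is
    injective, so the image w of \<omega> is a root of f of the same order.\<close>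
  interpret finite_field_closure "to_ac \<circ> h" q
    by unfold_locales (use assms in \<open>simp_all add: hom_distribs\<close>)
  define n where "n = mult_order \<omega>"
  define w where "w = to_ac \<omega>"
  define k where "k = card (UNIV :: 'b set) - 1"
  have "card {0, 1 :: 'b} \<le> card (UNIV :: 'b set)" by (rule card_mono) auto
  then have k: "k > 0" by (simp add: k_def)
  have wk: "w ^ k = 1"
    using finite_field_power_card_minus_1[OF \<open>\<omega> \<noteq> 0\<close>] unfolding w_def k_def
    by (simp flip: to_ac_power)
  have n_eq: "mult_order w = n"
    unfolding n_def mult_order_def w_def by (simp flip: to_ac_power)
  have "map_poly (to_ac \<circ> h) f = map_poly to_ac (map_poly h f)"
    by (simp add: map_poly_map_poly)
  then have root': "poly (map_poly (to_ac \<circ> h) f) w = 0"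
    using root by (simp add: w_def)
  have n: "n > 0" "coprime n q"
    using mult_order_pos[OF k wk] coprime_mult_order[OF k wk] by (simp_all add: n_eq)
  have "coprime t q \<and> ord (n * t) q = m * t \<longleftrightarrow>
    ord n q = m \<and> gcd 4 t dvd n \<and>
    (\<forall>p. prime p \<and> p dvd t \<longrightarrow> p dvd n \<and> \<not> p dvd (q ^ m - 1) div n)"
  \<comment> \<open>For f = 0 the degree m is 0, and both sides fail because orders to coprime
    moduli are positive.\<close>
  proof (cases "f = 0")
    case True
    then show ?thesis using m n by (auto simp: ord_eq_0)
  next
    case False
    then have "ord n q \<le> m" using ord_le_degree[OF k wk _ root'] m by (simp add: n_eq)
    then show ?thesis using ord_mult_eq_iff[OF n(1) \<open>t > 0\<close> _ n(2)] q_gt_1 by simp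
  qed
  then show "(hyper_irreducible t f \<longleftrightarrow>
             coprime t q \<and> ord (mult_order \<omega> * t) q = m * t) \<and>
          (coprime t q \<and> ord (mult_order \<omega> * t) q = m * t \<longleftrightarrow>
             ord (mult_order \<omega>) q = m \<and> gcd 4 t dvd mult_order \<omega> \<and>
             (\<forall>p. prime p \<and> p dvd t \<longrightarrow>
                p dvd mult_order \<omega> \<and> \<not> p dvd (q ^ m - 1) div mult_order \<omega>))"
    using hyper_irreducible_iff[OF k wk root' \<open>t > 0\<close>] n_eq m n_def by simp
next
  \<comment> \<open>In the second part no extension is given, so the closure of the base field
    supplies the roots.\<close>
  interpret finite_field_closure "to_ac :: 'a \<Rightarrow> _" q
    by unfold_locales (use assms in simp_all)
  fix m t :: nat
  assume "m > 0 \<and> t > 0"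
  then have "m > 0" "t > 0" by simp_all
  then show "((\<exists>f :: 'a poly. degree f = m \<and> hyper_irreducible t f) \<longleftrightarrow>
             coprime t q \<and> ord ((q ^ m - 1) * t) q = m * t) \<and>
          (coprime t q \<and> ord ((q ^ m - 1) * t) q = m * t \<longleftrightarrow>
             gcd t 4 * (\<Prod>p\<in>{p. prime p \<and> odd p \<and> p dvd t}. p) dvd q ^ m - 1)"
    using exists_hyper_irreducible[of m t] ord_of_hyper_irreducible[of _ t]
      ord_power_minus_one_mult_iff[OF q_gt_1] by blast
qed

end
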